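(* Let $f(x),g(x)\in\mathbb{Q}[x]$ be non-constant, both having only simple rational roots, with $\deg(f)\le\deg(g)$. Suppose the equation $f(x)=g(y)$ has infinitely many rational solutions with a bounded denominator, and that $f=\varphi(F(\kappa))$, $g=\varphi(G(\lambda))$ where $\kappa,\lambda\in\mathbb{Q}[x]$ are linear, $\varphi\in\mathbb{Q}[x]$, and $(F,G)$ is a standard pair over $\mathbb{Q}$ of the first or second kind such that $F(x)=G(y)$ has infinitely many rational solutions with a bounded denominator. Then, after replacing $f,g$ by similar polynomials $\tilde f(x)=f(ax+b)$, $\tilde g(y)=g(cy+d)$ for suitable $a,b,c,d\in\mathbb{Q}$ with $ac\neq0$, one of the following holds: 1. $\deg(f)\mid\deg(g)$, and there exist $G_0\in\mathbb{Q}[y]$ of degree $n\ge1$, $p_0\in\mathbb{Q}\setminus\{0\}$ and distinct $p_1,\dots,p_s\in\mathbb{Q}$ such that $\tilde f(x)=p_0\prod_{i=1}^s(x-p_i)$, $\tilde g(y)=p_0\prod_{i=1}^s(G_0(y)-p_i)$, the polynomials $G_0(y)-p_i$ $(i=1,\dots,s)$ form a $\mathrm{PTE}_n$ set, and for every $X\in\mathbb{Z}$ the pair $(x,y)=(G_0(X),X)$ is a solution of $\tilde f(x)=\tilde g(y)$. 2. $\deg(f)\mid 2\deg(g)$, and there exist $G_0\in\mathbb{Q}[y]$ of degree $n\ge1$, $q_0\in\mathbb{Q}\setminus\{0\}$ and distinct positive rationals $q_1,\dots,q_s$ such that $\tilde f(x)=q_0\prod_{i=1}^s(x-q_i)(x+q_i)$,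 $\tilde g(y)=q_0\prod_{i=1}^s(G_0(y)-q_i^2)$, $G_0$ has at most two (complex) roots of odd multiplicity, the polynomials $G_0(y)-q_i^2$ $(i=1,\dots,s)$ form a $\mathrm{PTE}_n$ set, the equation $x^2=G_0(y)$ has infinitely many rational solutions $(X_i,Y_i)$ $(i=1,2,\dots)$ with a bounded denominator, and these $(X_i,Y_i)$ are also solutions of $\tilde f(x)=\tilde g(y)$.
   Context: "Only simple rational roots" means all complex roots are rational and pairwise distinct. An equation $P(x)=Q(y)$ has infinitely many rational solutions with a bounded denominator if for some positive integer $\Delta$ there are infinitely many $(x,y)\in\mathbb{Q}^2$ with $P(x)=Q(y)$ and $(\Delta x,\Delta y)\in\mathbb{Z}^2$. $F,G\in\mathbb{Q}[x]$ form a standard pair of the first kind if $(F,G)$ or $(G,F)$ equals $(x^q,\alpha x^p v(x)^q)$ with $\alpha\in\mathbb{Q}\setminus\{0\}$, $q$ a positive integer, $0\le p<q$, $\gcd(p,q)=1$, $v\in\mathbb{Q}[x]$ nonzero, $p+\deg(v)>0$; of the second kind if $(F,G)$ or $(G,F)$ equals $(x^2,(\alpha x^2+\beta)v(x)^2)$ with $\alpha,\beta\in\mathbb{Q}\setminus\{0\}$ and $v\in\mathbb{Q}[x]$ nonzero. A $\mathrm{PTE}_n$ set is a finite set $\{F_1,\dots,F_s\}$ of polynomials in $\mathbb{Q}[x]$, each of degree $n$ and having only simple rational roots, such that $F_i-F_j$ is a nonzero rational constant for all $i\ne j$. *)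

theory Defs
  imports Complex_Main "HOL-Computational_Algebra.Computational_Algebra"
begin

abbreviation complex_poly :: "rat poly \<Rightarrow> complex poly" where
  "complex_poly P \<equiv> map_poly of_rat P"

definition only_simple_rational_roots :: "rat poly \<Rightarrow> bool" where
  "only_simple_rational_roots P \<longleftrightarrow>
     (\<forall>z. poly (complex_poly P) z = 0 \<longrightarrow> z \<in> \<rat> \<and> order z (complex_poly P) = 1)"

definition solutions_with_denominator :: "nat \<Rightarrow> rat poly \<Rightarrow> rat poly \<Rightarrow> (rat \<times> rat) set" where
  "solutions_with_denominator \<Delta> P Q =
     {(x, y). poly P x = poly Q y \<and> of_nat \<Delta> * x \<in> \<int> \<and> of_nat \<Delta> * y \<in> \<int>}"

definition infinitely_many_bounded_denominator_solutions :: "rat poly \<Rightarrow> rat poly \<Rightarrow> bool" where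
  "infinitely_many_bounded_denominator_solutions P Q \<longleftrightarrow>
     (\<exists>\<Delta>>0. infinite (solutions_with_denominator \<Delta> P Q))"

text \<open>The \<open>_form\<close> predicates fix the order of the two polynomials; a standard pair may come in
  either order.\<close>

definition first_kind_form :: "rat poly \<Rightarrow> rat poly \<Rightarrow> bool" where
  "first_kind_form F G \<longleftrightarrow>
     (\<exists>(q::nat) (p::nat) \<alpha> v. \<alpha> \<noteq> 0 \<and> q > 0 \<and> p < q \<and> coprime p q \<and> v \<noteq> 0 \<and> p + degree v > 0 \<and>
        F = monom 1 q \<and> G = monom \<alpha> p * v ^ q)"

definition second_kind_form :: "rat poly \<Rightarrow> rat poly \<Rightarrow> bool" where
  "second_kind_form F G \<longleftrightarrow>
     (\<exists>\<alpha> \<beta> v. \<alpha> \<noteq> 0 \<and> \<beta> \<noteq> 0 \<and> v \<noteq> 0 \<and>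
        F = monom 1 2 \<and> G = [:\<beta>, 0, \<alpha>:] * v ^ 2)"

definition standard_pair_first_kind :: "rat poly \<Rightarrow> rat poly \<Rightarrow> bool" where
  "standard_pair_first_kind F G \<longleftrightarrow> first_kind_form F G \<or> first_kind_form G F"

definition standard_pair_second_kind :: "rat poly \<Rightarrow> rat poly \<Rightarrow> bool" where
  "standard_pair_second_kind F G \<longleftrightarrow> second_kind_form F G \<or> second_kind_form G F"

definition PTE_set :: "nat \<Rightarrow> rat poly set \<Rightarrow> bool" where
  "PTE_set n S \<longleftrightarrow> finite S \<and>
     (\<forall>F\<in>S. degree F = n \<and> only_simple_rational_roots F) \<and>
     (\<forall>F\<in>S. \<forall>H\<in>S. F \<noteq> H \<longrightarrow> (\<exists>c. c \<noteq> 0 \<and> F - H = [:c:]))"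

end

theory Submission
  imports Defs
begin

text \<open>
  A root of \<open>\<phi>\<close> is the image under \<open>F \<circ> \<kappa>\<close> of a root of \<open>f\<close>, so \<open>\<phi>\<close> splits over the
  rationals as \<open>p\<^sub>0 \<Prod> (x - p\<^sub>i)\<close> with distinct \<open>p\<^sub>i\<close>, and every \<open>F - p\<^sub>i\<close> and \<open>G - p\<^sub>i\<close> again has only
  simple rational roots. Since \<open>x\<^sup>q - p\<^sub>i\<close> has at most two rational roots, the exponent \<open>q\<close> of a
  standard pair of the first kind is at most 2. As \<open>deg F \<le> deg G\<close>, this leaves \<open>F\<close> linear, which is
  the first alternative, or \<open>F = a x\<^sup>2 + b\<close>. In the latter case \<open>a x\<^sup>2 + b - p\<^sub>i\<close> has the roots
  \<open>\<plusminus> q\<^sub>i\<close>, and \<open>G\<^sub>0 = (G - b) / a\<close> gives the second alternative.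
\<close>

section \<open>Rational polynomials over the complex numbers\<close>

lemma complex_poly_add: "complex_poly (P + Q) = complex_poly P + complex_poly Q"
  by (rule poly_eqI) (simp add: coeff_map_poly of_rat_add)

lemma complex_poly_mult: "complex_poly (P * Q) = complex_poly P * complex_poly Q"
  by (rule poly_eqI) (simp add: coeff_map_poly coeff_mult of_rat_sum of_rat_mult)

lemma complex_poly_smult: "complex_poly (smult c P) = smult (of_rat c) (complex_poly P)"
  by (rule poly_eqI) (simp add: coeff_map_poly of_rat_mult)

lemma complex_poly_prod: "complex_poly (\<Prod>i\<in>A. P i) = (\<Prod>i\<in>A. complex_poly (P i))"
  by (induction A rule: infinite_finite_induct) (simp_all add: complex_poly_mult)

lemma complex_poly_pCons: "complex_poly (pCons c P) = pCons (of_rat c) (complex_poly P)"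
  by (simp add: map_poly_pCons)

lemma complex_poly_pcompose:
  "complex_poly (pcompose P Q) = pcompose (complex_poly P) (complex_poly Q)"
  by (induction P) (simp_all add: pcompose_pCons complex_poly_pCons complex_poly_add complex_poly_mult)

lemma degree_complex_poly: "degree (complex_poly P) = degree P"
  by (rule degree_map_poly) simp

lemma complex_poly_eq_0_iff: "complex_poly P = 0 \<longleftrightarrow> P = 0"
  by (auto simp: poly_eq_iff coeff_map_poly)

lemma inj_complex_poly: "complex_poly P = complex_poly Q \<Longrightarrow> P = Q"
  by (simp add: poly_eq_iff coeff_map_poly)

lemma poly_complex_poly: "poly (complex_poly P) (of_rat x) = of_rat (poly P x)"
  by (induction P) (simp_all add: complex_poly_pCons of_rat_add of_rat_mult)

text \<open>The square adds an even amount to each multiplicity, so a root of odd multiplicity must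
  already be a root of \<open>w\<close>. With \<open>degree w \<le> 2\<close> this yields the
  odd-multiplicity bound of the second alternative.\<close>

lemma card_odd_order_roots_le:
  assumes "w \<noteq> 0" "v \<noteq> 0"
  shows "card {z. poly (complex_poly (w * v ^ 2)) z = 0 \<and> odd (order z (complex_poly (w * v ^ 2)))}
    \<le> degree w"
proof -
  have w: "complex_poly w \<noteq> 0" and v: "complex_poly v \<noteq> 0"
    using assms by (simp_all add: complex_poly_eq_0_iff)
  have "order z (complex_poly (w * v ^ 2)) = order z (complex_poly w) + 2 * order z (complex_poly v)"
    for z
    using w v by (simp add: complex_poly_mult order_mult power2_eq_square)
  then have "{z. poly (complex_poly (w * v ^ 2)) z = 0 \<and> odd (order z (complex_poly (w * v ^ 2)))}
    \<subseteq> {z. poly (complex_poly w) z = 0}"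
    using w by (auto simp: order_root odd_pos)
  from card_mono[OF poly_roots_finite[OF w] this]
  show ?thesis using card_poly_roots_bound[OF w] by (simp add: degree_complex_poly)
qed

lemma degree_diff_const: "degree (P - [:c:]) = degree P"
  by (cases P) simp

text \<open>Undoes linear inner polynomials such as \<open>\<kappa>\<close> and
  \<open>\<mu>\<close>; the coefficients \<open>a, b, c, d\<close> of the similarity come from
  here.\<close>

lemma linear_inverse:
  fixes P :: "'a::field poly"
  assumes "degree P = 1"
  obtains a b where "a \<noteq> 0" "pcompose P [:b, a:] = [:0, 1:]"
proof -
  obtain c d where P: "P = [:d, c:]" and "c \<noteq> 0"
    using assms by (metis One_nat_def degree_eq_zeroE degree_pCons_eq_if nat.inject pCons_0_0
        pCons_cases zero_neq_one)
  show thesis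
    by (rule that[of "1 / c" "- d / c"]) (use \<open>c \<noteq> 0\<close> in \<open>simp_all add: P pcompose_pCons\<close>)
qed

section \<open>Polynomials with only simple rational roots\<close>

text \<open>The zero polynomial vanishes at \<open>\<i>\<close>, so rationality of the roots alone
  rules it out, without looking at \<open>order z 0\<close>.\<close>

lemma only_simple_rational_roots_nonzero:
  assumes "only_simple_rational_roots P"
  shows "P \<noteq> 0"
proof
  assume "P = 0"
  with assms have "\<i> \<in> \<rat>"
    by (simp add: only_simple_rational_roots_def)
  then obtain r where "\<i> = of_rat r"
    by (elim Rats_cases)
  then have "(of_rat (r * r) :: complex) = of_rat (- 1)"
    by (metis of_rat_mult i_squared of_rat_neg_one)
  then have "r * r = - 1"
    by (simp only: of_rat_eq_iff)
  then show False
    by (metis zero_le_square neg_0_le_iff_le not_one_le_zero)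
qed

text \<open>Passing to \<open>rsquarefree\<close> gives access to the derivative criterion and to
  the splitting over the complex numbers.\<close>

lemma only_simple_rational_roots_iff:
  "only_simple_rational_roots P \<longleftrightarrow>
     rsquarefree (complex_poly P) \<and> (\<forall>z. poly (complex_poly P) z = 0 \<longrightarrow> z \<in> \<rat>)"
  (is "_ \<longleftrightarrow> ?rhs")
proof
  assume P: "only_simple_rational_roots P"
  then have "complex_poly P \<noteq> 0"
    using only_simple_rational_roots_nonzero complex_poly_eq_0_iff by blast
  with P show ?rhs
    unfolding only_simple_rational_roots_def rsquarefree_def by (metis order_root)
next
  assume ?rhs
  then show "only_simple_rational_roots P"
    unfolding only_simple_rational_roots_def rsquarefree_def by (metis order_root)
qed

lemma only_simple_rational_roots_dvd:
  assumes "only_simple_rational_roots P" "Q dvd P"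
  shows "only_simple_rational_roots Q"
proof -
  have dvd: "complex_poly Q dvd complex_poly P"
    using assms(2) by (auto simp: complex_poly_mult)
  have P: "rsquarefree (complex_poly P)" "\<And>z. poly (complex_poly P) z = 0 \<Longrightarrow> z \<in> \<rat>"
    using assms(1) by (simp_all add: only_simple_rational_roots_iff)
  then have nz: "complex_poly P \<noteq> 0"
    by (simp add: rsquarefree_def)
  have "order z (complex_poly Q) \<le> 1" for z
    using dvd_imp_order_le[OF nz dvd, of z] P(1) unfolding rsquarefree_def
    by (metis le_zero_eq zero_le_one order.trans)
  then have "order z (complex_poly Q) = 0 \<or> order z (complex_poly Q) = 1" for z
    by (metis le_Suc_eq One_nat_def le_zero_eq)
  then show ?thesis
    using P(2) dvd nz by (auto simp: only_simple_rational_roots_iff rsquarefree_def)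
qed

text \<open>A root \<open>z\<close> of \<open>P\<close> lifts to some complex \<open>y\<close> with
  \<open>h(y) = z\<close>, which is a root of the composition. Hence \<open>y\<close> is rational,
  and so is \<open>z\<close>. By the chain rule \<open>P'(z) h'(y) \<noteq> 0\<close>, so
  \<open>z\<close> is simple.\<close>

lemma only_simple_rational_roots_outer:
  assumes "only_simple_rational_roots (pcompose P h)" "degree h > 0"
  shows "only_simple_rational_roots P"
proof -
  have *: "poly (pderiv (complex_poly P)) z \<noteq> 0 \<and> z \<in> \<rat>" if z: "poly (complex_poly P) z = 0" for z
  proof -
    have "degree (complex_poly h - [:z:]) > 0"
      using assms(2) by (simp add: degree_complex_poly degree_diff_const)
    then obtain y where y: "poly (complex_poly h) y = z"
      using alg_closed_imp_poly_has_root[of "complex_poly h - [:z:]"] by auto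
    have root: "poly (complex_poly (pcompose P h)) y = 0"
      by (simp add: complex_poly_pcompose poly_pcompose y z)
    then obtain x where "y = of_rat x"
      using assms(1) by (auto simp: only_simple_rational_roots_iff elim: Rats_cases)
    then have "z \<in> \<rat>"
      using y by (auto simp: poly_complex_poly)
    moreover have "poly (pderiv (complex_poly (pcompose P h))) y \<noteq> 0"
      using assms(1) root unfolding only_simple_rational_roots_iff rsquarefree_roots by blast
    then have "poly (pderiv (complex_poly P)) z \<noteq> 0"
      by (auto simp: complex_poly_pcompose pderiv_pcompose poly_pcompose y)
    ultimately show ?thesis by simp
  qed
  then show ?thesis
    by (auto simp: only_simple_rational_roots_iff rsquarefree_roots)
qed

text \<open>The splitting holds over the complex numbers; all its roots come from rationals, so it
  descends because \<open>complex_poly\<close> is injective.\<close>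

lemma only_simple_rational_roots_split:
  assumes "only_simple_rational_roots P"
  shows "P = smult (lead_coeff P) (\<Prod>x | poly P x = 0. [:- x, 1:])"
proof (rule inj_complex_poly)
  let ?C = "complex_poly P"
  have roots: "{z. poly ?C z = 0} = of_rat ` {x. poly P x = 0}"
    using assms by (force simp: only_simple_rational_roots_iff poly_complex_poly elim: Rats_cases)
  have "?C = smult (lead_coeff ?C) (\<Prod>z | poly ?C z = 0. [:- z, 1:])"
    using assms complex_poly_decompose_rsquarefree[of ?C] by (simp add: only_simple_rational_roots_iff)
  also have "(\<Prod>z | poly ?C z = 0. [:- z, 1:]) = (\<Prod>x | poly P x = 0. [:- of_rat x, 1:])"
    unfolding roots by (subst prod.reindex) (auto simp: inj_on_def)
  also have "\<dots> = complex_poly (\<Prod>x | poly P x = 0. [:- x, 1:])"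
    by (simp add: complex_poly_prod complex_poly_pCons of_rat_minus)
  finally show "?C = complex_poly (smult (lead_coeff P) (\<Prod>x | poly P x = 0. [:- x, 1:]))"
    by (simp add: complex_poly_smult degree_complex_poly coeff_map_poly)
qed

lemma only_simple_rational_roots_card:
  assumes "only_simple_rational_roots P"
  shows "card {x. poly P x = 0} = degree P"
proof -
  have "lead_coeff P \<noteq> 0"
    using only_simple_rational_roots_nonzero[OF assms] by simp
  then have "degree P = degree (\<Prod>x | poly P x = 0. [:- x, 1:])"
    by (metis only_simple_rational_roots_split[OF assms] degree_smult_eq)
  also have "\<dots> = card {x. poly P x = 0}"
    by (simp add: degree_prod_eq_sum_degree)
  finally show ?thesis ..
qed

lemma only_simple_rational_roots_obtain:
  assumes "only_simple_rational_roots P"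
  obtains c p where "c \<noteq> 0" "inj_on p {1..degree P}"
    "P = smult c (\<Prod>i = 1..degree P. [:- p i, 1:])"
proof -
  have nz: "P \<noteq> 0"
    using only_simple_rational_roots_nonzero[OF assms] .
  obtain p where p: "bij_betw p {1..degree P} {x. poly P x = 0}"
    using ex_bij_betw_nat_finite_1[OF poly_roots_finite[OF nz]] only_simple_rational_roots_card[OF assms]
    by auto
  have "P = smult (lead_coeff P) (\<Prod>i = 1..degree P. [:- p i, 1:])"
    using only_simple_rational_roots_split[OF assms]
      prod.reindex_bij_betw[OF p, of "\<lambda>x. [:- x, 1:]"] by simp
  with p nz show thesis
    by (intro that[of "lead_coeff P" p]) (auto simp: bij_betw_def)
qed

section \<open>Pure powers, even quadratics and families of shifts\<close>

text \<open>Two rational \<open>q\<close>-th roots of \<open>c\<close> have the same absolute value,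
  so there are at most two of them, whereas simple rational roots must number
  \<open>q\<close>.\<close>

lemma only_simple_rational_roots_monom_le_2:
  assumes "only_simple_rational_roots (monom 1 q - [:c:])" "q > 0"
  shows "q \<le> 2"
proof -
  let ?P = "monom 1 q - [:c:] :: rat poly"
  have deg: "degree ?P = q"
    by (simp add: degree_diff_const degree_monom_eq)
  have card: "card {x. poly ?P x = 0} = q"
    using only_simple_rational_roots_card[OF assms(1)] deg by simp
  \<comment> \<open>The root set has \<open>q > 0\<close> elements, so it is nonempty.\<close>
  then obtain r where r: "r ^ q = c"
    using assms(2) by (cases "{x. poly ?P x = 0} = {}") (auto simp: poly_monom)
  have "{x. poly ?P x = 0} \<subseteq> {r, - r}"
  proof
    fix x assume "x \<in> {x. poly ?P x = 0}"
    then have "\<bar>x\<bar> ^ q = \<bar>r\<bar> ^ q"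
      using r by (simp add: poly_monom flip: power_abs)
    then have "\<bar>x\<bar> = \<bar>r\<bar>"
      using assms(2) by (simp add: power_eq_iff_eq_base)
    then show "x \<in> {r, - r}" by (auto simp: abs_eq_iff)
  qed
  then have "card {x. poly ?P x = 0} \<le> card {r, - r}"
    by (intro card_mono) auto
  also have "\<dots> \<le> 2"
    by (simp add: card_insert_if)
  finally show ?thesis using card by simp
qed

text \<open>Of two distinct roots one is nonzero, and since the polynomial is even the absolute
  value of that root is again a root.\<close>

lemma only_simple_rational_roots_quadratic:
  assumes "only_simple_rational_roots [:b, 0, a:]" "a \<noteq> 0"
  obtains r where "r > 0" "a * r\<^sup>2 = - b"
proof -
  have "card {x. poly [:b, 0, a:] x = 0} = 2"
    using only_simple_rational_roots_card[OF assms(1)] assms(2) by simp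
  then obtain x y where "poly [:b, 0, a:] x = 0" "poly [:b, 0, a:] y = 0" "x \<noteq> y"
    by (auto simp: card_2_iff)
  then obtain r where "r \<noteq> 0" "poly [:b, 0, a:] r = 0"
    by metis
  then have "\<bar>r\<bar> > 0" "a * \<bar>r\<bar>\<^sup>2 = - b"
    by (simp_all add: power2_eq_square algebra_simps eq_neg_iff_add_eq_0)
  then show thesis by (rule that)
qed

lemma degree_monom_mult_power:
  fixes \<alpha> :: rat
  assumes "\<alpha> \<noteq> 0" "v \<noteq> 0"
  shows "degree (monom \<alpha> p * v ^ q) = p + q * degree v"
  using assms by (simp add: degree_mult_eq degree_power_eq degree_monom_eq monom_eq_0_iff)

lemma PTE_set_shifts:
  assumes "degree G = n" "finite I"
    and "\<And>i. i \<in> I \<Longrightarrow> only_simple_rational_roots (G - [:p i:])"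
  shows "PTE_set n ((\<lambda>i. G - [:p i:]) ` I)"
  unfolding PTE_set_def
proof (intro conjI ballI impI)
  fix F H assume "F \<in> (\<lambda>i. G - [:p i:]) ` I" "H \<in> (\<lambda>i. G - [:p i:]) ` I" "F \<noteq> H"
  then obtain i j where "F = G - [:p i:]" "H = G - [:p j:]" "p j - p i \<noteq> 0"
    by auto
  then show "\<exists>c. c \<noteq> 0 \<and> F - H = [:c:]"
    by (intro exI[of _ "p j - p i"]) simp
qed (use assms in \<open>auto simp: degree_diff_const\<close>)

section \<open>The decomposition\<close>

text \<open>Reduces both kinds, in both orders, to two cases. In \<open>quadratic\<close> the
  equation \<open>F(x) = G(y)\<close> reads \<open>a x^2 = G(y) - b\<close>, with the right side a
  square times a factor of degree at most 2. A single \<open>c\<close> suffices to bound the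
  exponent.\<close>

lemma standard_pair_shape:
  assumes "standard_pair_first_kind F G \<or> standard_pair_second_kind F G"
    and deg: "degree F \<le> degree G" "degree F > 0"
    and F: "only_simple_rational_roots (F - [:c:])" and G: "only_simple_rational_roots (G - [:c:])"
  obtains (linear) "degree F = 1"
  | (quadratic) a b w v where "a \<noteq> 0" "F = [:b, 0, a:]" "G - [:b:] = w * v ^ 2"
      "w \<noteq> 0" "v \<noteq> 0" "degree w \<le> 2"
proof -
  have monom2: "monom (1::rat) 2 = [:0, 0, 1:]"
    by (simp add: monom_altdef power2_eq_square)
  consider "first_kind_form F G" | "first_kind_form G F" | "second_kind_form F G"
    | "second_kind_form G F"
    using assms(1) by (auto simp: standard_pair_first_kind_def standard_pair_second_kind_def)
  then show thesis
  proof cases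
    case 1
    then obtain q p \<alpha> v where *: "\<alpha> \<noteq> 0" "q > 0" "p < q" "coprime p q" "v \<noteq> 0"
        "F = monom 1 q" "G = monom \<alpha> p * v ^ q"
      unfolding first_kind_form_def by blast
    have "q \<le> 2"
      using only_simple_rational_roots_monom_le_2 F * by blast
    \<comment> \<open>Coprimality forces \<open>q = 1\<close> when \<open>p = 0\<close>.\<close>
    then consider "q = 1" | "q = 2" "p = 1"
      using * by (cases "p = 0") force+
    then show thesis
    proof cases
      case 1
      then show thesis using * linear by (simp add: degree_monom_eq)
    next
      case 2
      show thesis
        by (rule quadratic[of 1 0 "monom \<alpha> 1" v])
          (use * 2 monom2 in \<open>simp_all add: degree_monom_eq monom_eq_0_iff\<close>)
    qed
  next
    case 2
    then obtain q p \<alpha> v where *: "\<alpha> \<noteq> 0" "q > 0" "p < q" "coprime p q" "v \<noteq> 0"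
        "G = monom 1 q" "F = monom \<alpha> p * v ^ q"
      unfolding first_kind_form_def by blast
    have "q \<le> 2"
      using only_simple_rational_roots_monom_le_2 G * by blast
    moreover have "p + q * degree v \<le> q" "p + q * degree v > 0"
      using deg * by (simp_all add: degree_monom_mult_power degree_monom_eq)
    \<comment> \<open>If \<open>v\<close> is constant, then \<open>0 < p < q \<le> 2\<close> gives
      \<open>p = 1\<close>. Otherwise the degree bound gives \<open>p = 0\<close> and
      \<open>degree v = 1\<close>, and coprimality gives \<open>q = 1\<close>.\<close>
    ultimately have "p + q * degree v = 1"
      using * by (cases "degree v") (force simp: numeral_2_eq_2 le_Suc_eq)+
    then show thesis
      using * linear by (simp add: degree_monom_mult_power)
  next
    case 3
    then obtain \<alpha> \<beta> v where *: "\<alpha> \<noteq> 0" "v \<noteq> 0" "F = monom 1 2" "G = [:\<beta>, 0, \<alpha>:] * v ^ 2"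
      unfolding second_kind_form_def by blast
    show thesis
      by (rule quadratic[of 1 0 "[:\<beta>, 0, \<alpha>:]" v]) (use * monom2 in simp_all)
  next
    case 4
    then obtain \<alpha> \<beta> v where *: "\<alpha> \<noteq> 0" "v \<noteq> 0" "G = monom 1 2" "F = [:\<beta>, 0, \<alpha>:] * v ^ 2"
      unfolding second_kind_form_def by blast
    have "degree ([:\<beta>, 0, \<alpha>:] * v ^ 2) = 2 + 2 * degree v"
      using * by (subst degree_mult_eq) (simp_all add: degree_power_eq)
    then have "degree v = 0"
      using deg * by (simp add: degree_monom_eq)
    then obtain e where v: "v = [:e:]"
      by (rule degree_eq_zeroE)
    \<comment> \<open>Here \<open>G = x^2\<close> and
      \<open>F = \<alpha> e^2 x^2 + \<beta> e^2\<close>; the whole of \<open>G - [:b:]\<close> is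
      quadratic and serves as \<open>w\<close>, with trivial square factor.\<close>
    show thesis
      by (rule quadratic[of "\<alpha> * e\<^sup>2" "\<beta> * e\<^sup>2" "[:- (\<beta> * e\<^sup>2), 0, 1:]" 1])
        (use * v monom2 in \<open>simp_all add: power2_eq_square\<close>)
  qed
qed

theorem theorem6p1:
  fixes f g \<phi> F G \<kappa> \<mu> :: "rat poly"
  assumes "degree f > 0" and "degree g > 0"
    and "only_simple_rational_roots f" and "only_simple_rational_roots g"
    and "degree f \<le> degree g"
    and "infinitely_many_bounded_denominator_solutions f g"
    and "degree \<kappa> = 1" and "degree \<mu> = 1"
    and "f = pcompose \<phi> (pcompose F \<kappa>)" and "g = pcompose \<phi> (pcompose G \<mu>)"
    and "standard_pair_first_kind F G \<or> standard_pair_second_kind F G"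
    and "infinitely_many_bounded_denominator_solutions F G"
  shows "\<exists>(a::rat) b (c::rat) d ft gt. a * c \<noteq> 0 \<and>
    ft = pcompose f [:b, a:] \<and> gt = pcompose g [:d, c:] \<and>
    ((degree f dvd degree g \<and>
      (\<exists>(G0::rat poly) (n::nat) (p0::rat) (s::nat) (p::nat \<Rightarrow> rat).
         degree G0 = n \<and> n \<ge> 1 \<and> p0 \<noteq> 0 \<and> inj_on p {1..s} \<and>
         ft = smult p0 (\<Prod>i=1..s. [:- p i, 1:]) \<and>
         gt = smult p0 (\<Prod>i=1..s. G0 - [:p i:]) \<and>
         PTE_set n ((\<lambda>i. G0 - [:p i:]) ` {1..s}) \<and>
         (\<forall>X::int. poly ft (poly G0 (of_int X)) = poly gt (of_int X))))
     \<or>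
     (degree f dvd 2 * degree g \<and>
      (\<exists>(G0::rat poly) (n::nat) (q0::rat) (s::nat) (q::nat \<Rightarrow> rat).
         degree G0 = n \<and> n \<ge> 1 \<and> q0 \<noteq> 0 \<and> inj_on q {1..s} \<and> (\<forall>i\<in>{1..s}. q i > 0) \<and>
         ft = smult q0 (\<Prod>i=1..s. [:- q i, 1:] * [:q i, 1:]) \<and>
         gt = smult q0 (\<Prod>i=1..s. G0 - [:(q i)\<^sup>2:]) \<and>
         card {z. poly (complex_poly G0) z = 0 \<and> odd (order z (complex_poly G0))} \<le> 2 \<and>
         PTE_set n ((\<lambda>i. G0 - [:(q i)\<^sup>2:]) ` {1..s}) \<and>
         (\<exists>\<Delta>>0. infinite (solutions_with_denominator \<Delta> (monom 1 2) G0) \<and>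
            solutions_with_denominator \<Delta> (monom 1 2) G0 \<subseteq> {(x, y). poly ft x = poly gt y}))))"
proof -
  have deg: "degree f = degree \<phi> * degree F" "degree g = degree \<phi> * degree G"
    using assms(7-10) by (simp_all add: degree_pcompose)
  then have pos: "degree \<phi> > 0" "degree F > 0" "degree G > 0" "degree F \<le> degree G"
    using assms(1,2,5) by auto
  have "only_simple_rational_roots \<phi>"
    using only_simple_rational_roots_outer[of \<phi> "pcompose F \<kappa>"] assms(3,7,9) pos
    by (simp add: degree_pcompose)
  then obtain p0 p where p: "p0 \<noteq> 0" "inj_on p {1..degree \<phi>}"
    and \<phi>: "\<phi> = smult p0 (\<Prod>i = 1..degree \<phi>. [:- p i, 1:])"
    by (rule only_simple_rational_roots_obtain)
  define s where "s = degree \<phi>"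
  have shift: "[:- x:] + H = H - [:x:]" for x and H :: "rat poly"
    by (cases H) simp
  have pcompose_\<phi>: "pcompose \<phi> H = smult p0 (\<Prod>i = 1..s. H - [:p i:])" for H
    by (subst \<phi>) (simp add: s_def shift pcompose_smult pcompose_prod pcompose_pCons)
  \<comment> \<open>By associativity \<open>\<nu>\<close> is the inner polynomial of a composition
    and can be stripped; each \<open>H - [:p i:]\<close> is then a factor of
    \<open>pcompose \<phi> H\<close>.\<close>
  have factor: "only_simple_rational_roots (H - [:p i:])"
    if "only_simple_rational_roots (pcompose \<phi> (pcompose H \<nu>))" "degree \<nu> = 1" "i \<in> {1..s}"
    for H \<nu> i
  proof -
    have "only_simple_rational_roots (pcompose \<phi> H)"
      using only_simple_rational_roots_outer[of "pcompose \<phi> H" \<nu>] that by (simp add: pcompose_assoc)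
    moreover have "H - [:p i:] dvd pcompose \<phi> H"
      using that unfolding pcompose_\<phi> by (intro dvd_smult dvd_prodI) simp_all
    ultimately show ?thesis
      by (rule only_simple_rational_roots_dvd)
  qed
  have Fi: "only_simple_rational_roots (F - [:p i:])" if "i \<in> {1..s}" for i
    using factor[of F \<kappa>] assms(3,7,9) that by simp
  have Gi: "only_simple_rational_roots (G - [:p i:])" if "i \<in> {1..s}" for i
    using factor[of G \<mu>] assms(4,8,10) that by simp
  obtain c d where c: "c \<noteq> 0" and "pcompose \<mu> [:d, c:] = [:0, 1:]"
    using linear_inverse assms(8) by blast
  then have gt: "pcompose g [:d, c:] = pcompose \<phi> G"
    using assms(10) by (simp flip: pcompose_assoc)
  \<comment> \<open>Since \<open>\<phi>\<close> is non-constant, the root \<open>p 1\<close> exists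
    and can play the role of \<open>c\<close> in \<open>standard_pair_shape\<close>.\<close>
  have one: "1 \<in> {1..s}"
    using pos by (simp add: s_def)
  show ?thesis
    using assms(11) pos(4,2) Fi[OF one] Gi[OF one]
  proof (cases rule: standard_pair_shape)
    case linear
    then have "degree (pcompose F \<kappa>) = 1"
      using assms(7) by (simp add: degree_pcompose)
    \<comment> \<open>The substitution inverts all of \<open>pcompose F \<kappa>\<close>, turning
      \<open>f\<close> into \<open>\<phi>\<close> itself, so \<open>G\<close> can be taken as
      \<open>G0\<close>.\<close>
    then obtain a b where a: "a \<noteq> 0" and "pcompose (pcompose F \<kappa>) [:b, a:] = [:0, 1:]"
      using linear_inverse by blast
    then have ft: "pcompose f [:b, a:] = \<phi>"
      using assms(9) by (simp flip: pcompose_assoc)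
    have "PTE_set (degree G) ((\<lambda>i. G - [:p i:]) ` {1..s})"
      using Gi by (intro PTE_set_shifts) simp_all
    moreover have "degree f dvd degree g"
      using deg linear by simp
    moreover have "\<phi> = smult p0 (\<Prod>i = 1..s. [:- p i, 1:])"
      using \<phi> by (simp add: s_def)
    moreover have "\<forall>X::int. poly \<phi> (poly G (of_int X)) = poly (pcompose \<phi> G) (of_int X)"
      by (simp add: poly_pcompose)
    moreover have "a * c \<noteq> 0" "degree G \<ge> 1" "inj_on p {1..s}"
      using a c pos p by (simp_all add: s_def)
    ultimately show ?thesis
      using ft[symmetric] gt[symmetric] p(1) pcompose_\<phi>[of G]
      apply -
      apply (rule exI[of _ a], rule exI[of _ b], rule exI[of _ c], rule exI[of _ d])
      apply (rule exI[of _ \<phi>], rule exI[of _ "pcompose \<phi> G"])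
      apply (intro conjI disjI1, assumption+)
      apply (rule exI[of _ G], rule exI[of _ "degree G"], rule exI[of _ p0], rule exI[of _ s],
          rule exI[of _ p])
      apply (intro conjI; (assumption | rule refl))
      done
  next
    case (quadratic \<alpha> \<beta> w v)
    \<comment> \<open>Now \<open>F\<close> is quadratic, so only \<open>\<kappa>\<close> is inverted
      and \<open>F\<close> remains inside \<open>\<phi>\<close>.\<close>
    obtain a b where a: "a \<noteq> 0" and "pcompose \<kappa> [:b, a:] = [:0, 1:]"
      using linear_inverse assms(7) by blast
    then have ft: "pcompose f [:b, a:] = pcompose \<phi> F"
      using assms(9) by (simp flip: pcompose_assoc)
    have "\<exists>r>0. \<alpha> * r\<^sup>2 = p i - \<beta>" if "i \<in> {1..s}" for i
      using only_simple_rational_roots_quadratic[of "\<beta> - p i" \<alpha>] Fi[OF that] quadratic(1,2) by auto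
    then obtain q where q: "\<And>i. i \<in> {1..s} \<Longrightarrow> q i > 0 \<and> \<alpha> * (q i)\<^sup>2 = p i - \<beta>"
      by metis
    \<comment> \<open>Since \<open>F = \<alpha> x^2 + \<beta>\<close>, this normalization turns
      \<open>F(x) = G(y)\<close> into \<open>x^2 = G0(y)\<close>.\<close>
    define G0 where "G0 = smult (1 / \<alpha>) (G - [:\<beta>:])"
    have F_factor: "F - [:p i:] = smult \<alpha> ([:- q i, 1:] * [:q i, 1:])" if "i \<in> {1..s}" for i
      using q[OF that] by (simp add: quadratic(2) power2_eq_square algebra_simps)
    have G_factor: "G - [:p i:] = smult \<alpha> (G0 - [:(q i)\<^sup>2:])" if "i \<in> {1..s}" for i
      using q[OF that] quadratic(1) by (simp add: G0_def smult_diff_right)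
    \<comment> \<open>Each of the \<open>s\<close> factors contributes one \<open>\<alpha>\<close>,
      on both sides of the equation; this explains the common constant
      \<open>p0 * \<alpha> ^ s\<close>.\<close>
    have ft_prod: "pcompose \<phi> F = smult (p0 * \<alpha> ^ s) (\<Prod>i = 1..s. [:- q i, 1:] * [:q i, 1:])"
      unfolding pcompose_\<phi> by (subst prod.cong[OF refl F_factor])
        (simp_all add: prod_smult del: mult_pCons_left mult_pCons_right smult_pCons)
    have gt_prod: "pcompose \<phi> G = smult (p0 * \<alpha> ^ s) (\<Prod>i = 1..s. G0 - [:(q i)\<^sup>2:])"
      unfolding pcompose_\<phi> by (subst prod.cong[OF refl G_factor]) (simp_all add: prod_smult)
    have inj_q: "inj_on q {1..s}"
    proof (rule inj_onI)
      fix i j assume "i \<in> {1..s}" "j \<in> {1..s}" "q i = q j"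
      then have "p i = p j"
        using q[of i] q[of j] by simp
      then show "i = j"
        using p(2) \<open>i \<in> {1..s}\<close> \<open>j \<in> {1..s}\<close> unfolding s_def by (metis inj_onD)
    qed
    have degG0: "degree G0 = degree G"
      using quadratic(1) by (simp add: G0_def degree_diff_const)
    have "only_simple_rational_roots (G0 - [:(q i)\<^sup>2:])" if "i \<in> {1..s}" for i
      using only_simple_rational_roots_dvd[OF Gi[OF that]] G_factor[OF that] by (simp add: dvd_smult)
    then have PTE: "PTE_set (degree G) ((\<lambda>i. G0 - [:(q i)\<^sup>2:]) ` {1..s})"
      using degG0 by (intro PTE_set_shifts) simp_all
    have "G0 = smult (1 / \<alpha>) w * v ^ 2"
      using quadratic(3) by (simp add: G0_def)
    then have odd: "card {z. poly (complex_poly G0) z = 0 \<and> odd (order z (complex_poly G0))} \<le> 2"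
      using card_odd_order_roots_le[of "smult (1 / \<alpha>) w" v] quadratic by simp
    \<comment> \<open>The two equations are equivalent pointwise, so infinitude carries over from
      \<open>F\<close> and \<open>G\<close> with the same \<open>\<Delta>\<close>; applying
      \<open>\<phi>\<close> to both sides then solves the transformed equation.\<close>
    have sols: "solutions_with_denominator \<Delta> (monom 1 2) G0 = solutions_with_denominator \<Delta> F G" for \<Delta>
      using quadratic(1)
      by (auto simp: solutions_with_denominator_def G0_def quadratic(2) poly_monom field_simps
          power2_eq_square)
    obtain \<Delta> where "\<Delta> > 0" "infinite (solutions_with_denominator \<Delta> (monom 1 2) G0)"
      using assms(12) unfolding sols infinitely_many_bounded_denominator_solutions_def by blast
    moreover have "solutions_with_denominator \<Delta> (monom 1 2) G0 \<subseteq>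
        {(x, y). poly (pcompose \<phi> F) x = poly (pcompose \<phi> G) y}"
      unfolding sols by (auto simp: solutions_with_denominator_def poly_pcompose)
    \<comment> \<open>As \<open>degree F = 2\<close>, the cofactor is
      \<open>degree G\<close>.\<close>
    moreover have "degree f dvd 2 * degree g"
      using deg quadratic(1,2) by (simp add: dvd_def mult.commute flip: mult_2)
    moreover have "a * c \<noteq> 0" "degree G \<ge> 1" "p0 * \<alpha> ^ s \<noteq> 0" "\<forall>i\<in>{1..s}. q i > 0"
      using a c pos p q quadratic(1) by simp_all
    ultimately show ?thesis
      using ft[symmetric] gt[symmetric] ft_prod gt_prod inj_q PTE odd degG0
      apply -
      apply (rule exI[of _ a], rule exI[of _ b], rule exI[of _ c], rule exI[of _ d])
      apply (rule exI[of _ "pcompose \<phi> F"], rule exI[of _ "pcompose \<phi> G"])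
      apply (intro conjI disjI2, assumption+)
      apply (rule exI[of _ G0], rule exI[of _ "degree G"], rule exI[of _ "p0 * \<alpha> ^ s"],
          rule exI[of _ s], rule exI[of _ q])
      apply (intro conjI exI[of _ \<Delta>]; assumption)
      done
  qed
qed

end
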